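(* For every $n\in\mathbb{N}$, the set \[ \Pi_n:=\{\operatorname{radii}(P): P \text{ is a compact } n\text{-packing with } \max \operatorname{radii}(P)=1\} \] is finite.
   Context: For a set $Q$ of discs in the plane, $\operatorname{radii}(Q):=\{r_D : D\in Q\}$, where $r_D$ is the radius of $D$. For $m\in\mathbb{N}$, a corona is a collection of closed discs $C,D_0,\dots,D_{m-1}$ in the plane with pairwise disjoint interiors such that for every $i\in\{0,\dots,m-1\}$ the disc $D_i$ is tangent to both $C$ and $D_{i+1 \bmod m}$; $C$ is its center and $D_0,\dots,D_{m-1}$ its petals. A compact packing of the plane by discs is a collection $P$ of closed discs in the plane with pairwise disjoint interiors such that every disc $C\in P$ is the center of a corona whose petals belong to $P$. A compact $n$-packing is a compact packing $P$ with $|\operatorname{radii}(P)|=n$.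
   Formalization: A corona is additionally required to have its petals go once around the center (consecutive angles at the center positive, summing to 2π); with tangency alone the claim fails, e.g. four mutually tangent discs form a compact packing with continuously varying radii. *)

theory Defs
  imports "HOL-Analysis.Analysis"
begin

type_synonym disc = "complex \<times> real"

definition is_disc :: "disc \<Rightarrow> bool" where
  "is_disc D \<longleftrightarrow> snd D > 0"

definition disc_set :: "disc \<Rightarrow> complex set" where
  "disc_set D = cball (fst D) (snd D)"

definition int_disjoint :: "disc \<Rightarrow> disc \<Rightarrow> bool" where
  "int_disjoint D E \<longleftrightarrow> interior (disc_set D) \<inter> interior (disc_set E) = {}"

definition tangent :: "disc \<Rightarrow> disc \<Rightarrow> bool" where
  "tangent D E \<longleftrightarrow> dist (fst D) (fst E) = snd D + snd E"

definition petal_angle :: "disc \<Rightarrow> disc \<Rightarrow> disc \<Rightarrow> real" where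
  "petal_angle C D E = Arg ((fst E - fst C) / (fst D - fst C))"

definition corona :: "disc \<Rightarrow> (nat \<Rightarrow> disc) \<Rightarrow> nat \<Rightarrow> bool" where
  "corona C Ds m \<longleftrightarrow>
     is_disc C \<and> (\<forall>i<m. is_disc (Ds i)) \<and>
     (\<forall>i<m. int_disjoint C (Ds i)) \<and>
     (\<forall>i<m. \<forall>j<m. i \<noteq> j \<longrightarrow> int_disjoint (Ds i) (Ds j)) \<and>
     (\<forall>i<m. tangent (Ds i) C \<and> tangent (Ds i) (Ds (Suc i mod m))) \<and>
     (\<forall>i<m. petal_angle C (Ds i) (Ds (Suc i mod m)) > 0) \<and>
     (\<Sum>i<m. petal_angle C (Ds i) (Ds (Suc i mod m))) = 2 * pi"

definition radii :: "disc set \<Rightarrow> real set" where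
  "radii Q = snd ` Q"

definition compact_packing :: "disc set \<Rightarrow> bool" where
  "compact_packing P \<longleftrightarrow>
     (\<forall>D\<in>P. is_disc D) \<and>
     (\<forall>D\<in>P. \<forall>E\<in>P. D \<noteq> E \<longrightarrow> int_disjoint D E) \<and>
     (\<forall>C\<in>P. \<exists>m Ds. corona C Ds m \<and> (\<forall>i<m. Ds i \<in> P))"

definition compact_n_packing :: "nat \<Rightarrow> disc set \<Rightarrow> bool" where
  "compact_n_packing n P \<longleftrightarrow> compact_packing P \<and> finite (radii P) \<and> card (radii P) = n"

end

theory Submission
  imports Defs
begin

text \<open>
  Number the radii of a packing increasingly. To each radius class attach the set of all sequences
  of radius classes of the petals that occur in coronas around discs of that class. The angles of a
  corona add up to \<open>2\<pi>\<close>, and each of them is strictly increasing in the petal radii relative to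
  the radius of the center. This yields a maximum principle: if two packings share these data and
  their radii satisfy \<open>\<rho> \<le> c \<rho>'\<close>, then equality at a class forces equality at all classes of petals
  occurring around it. The classes where equality holds cannot be all smaller than the largest
  one, because the discs in a set of classes closed under taking petals form a compact packing,
  and such a packing leaves no room for a disc at least as large as all of its discs.

  Hence the data of the classes below the largest one determine the normalised radii. Moreover, if
  two packings share the data of the first \<open>k\<close> classes, then the \<open>k\<close>-th radius of one of them, relative
  to its smallest radius, is at most the largest relative radius of the other. So if finitely many
  data occur for the first \<open>k\<close> classes, the relative radius of the \<open>k\<close>-th class is bounded, thus so is
  the number of petals around its discs, and finitely many data occur for the first \<open>k + 1\<close> classes.
\<close>

section \<open>Angles between mutually tangent discs\<close>

text \<open>The angle, at the center of a disc of radius \<open>r\<close>, of the triangle spanned by the centers of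
  three mutually tangent discs of radii \<open>r\<close>, \<open>a\<close>, \<open>b\<close>.\<close>

definition ang :: "real \<Rightarrow> real \<Rightarrow> real \<Rightarrow> real" where
  "ang r a b = arccos (1 - 2 * (a / (r + a)) * (b / (r + b)))"

lemma ratio_mono:
  fixes r a a' r' :: real
  assumes "0 < r" "0 < a" "0 < r'" "a * r' \<le> a' * r" "0 < a'"
  shows "a / (r + a) \<le> a' / (r' + a')"
  using assms by (simp add: field_simps)

lemma ratio_less:
  fixes r a a' r' :: real
  assumes "0 < r" "0 < a" "0 < r'" "a * r' < a' * r" "0 < a'"
  shows "a / (r + a) < a' / (r' + a')"
  using assms by (simp add: field_simps)

lemma ratio_bounds:
  fixes r a :: real
  assumes "0 < r" "0 < a"
  shows "0 < a / (r + a)" "a / (r + a) < 1"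
  using assms by (simp_all add: field_simps)

lemma mult_unit_interval:
  fixes x y :: real
  assumes "0 < x" "x < 1" "0 < y" "y < 1"
  shows "0 < x * y" "x * y < 1"
  using assms mult_strict_mono[of x 1 y 1] by auto

text \<open>The factors \<open>a / (r + a)\<close> and \<open>b / (r + b)\<close> grow with the
  relative radii \<open>a / r\<close> and \<open>b / r\<close>, which are compared by
  cross-multiplication, and \<open>arccos\<close> is decreasing.\<close>

lemma ang_mono:
  assumes "0 < r" "0 < a" "0 < b" "0 < r'" "0 < a'" "0 < b'" "a * r' \<le> a' * r" "b * r' \<le> b' * r"
  shows "ang r a b \<le> ang r' a' b'"
proof -
  let ?x = "a / (r + a)" and ?y = "b / (r + b)" and ?x' = "a' / (r' + a')" and ?y' = "b' / (r' + b')"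
  have "?x * ?y \<le> ?x' * ?y'"
    using ratio_mono[of r a r' a'] ratio_mono[of r b r' b'] assms
    by (intro mult_mono) simp_all
  moreover have "0 < ?x * ?y" "?x' * ?y' < 1"
    by (intro mult_unit_interval ratio_bounds assms)+
  ultimately show ?thesis unfolding ang_def
    by (intro arccos_le_arccos) (auto simp: mult.assoc)
qed

lemma ang_less:
  assumes "0 < r" "0 < a" "0 < b" "0 < r'" "0 < a'" "0 < b'" "a * r' < a' * r" "b * r' \<le> b' * r"
  shows "ang r a b < ang r' a' b'"
proof -
  let ?x = "a / (r + a)" and ?y = "b / (r + b)" and ?x' = "a' / (r' + a')" and ?y' = "b' / (r' + b')"
  have "?x * ?y < ?x' * ?y'"
    using ratio_less[of r a r' a'] ratio_mono[of r b r' b'] assms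
    by (intro mult_less_le_imp_less) simp_all
  moreover have "0 < ?x * ?y" "?x' * ?y' < 1"
    by (intro mult_unit_interval ratio_bounds assms)+
  ultimately show ?thesis unfolding ang_def
    by (intro arccos_less_arccos) (auto simp: mult.assoc)
qed

text \<open>Law of cosines in the triangle of centers, whose sides are sums of radii. It gives the
  angle up to sign; positivity fixes the sign.\<close>

lemma petal_angle_eq_ang:
  assumes pos: "is_disc C" "is_disc D" "is_disc E"
    and tan: "tangent D C" "tangent E C" "tangent D E"
    and ang: "petal_angle C D E > 0"
  shows "petal_angle C D E = ang (snd C) (snd D) (snd E)"
proof -
  define r d e where "r = snd C" "d = snd D" "e = snd E"
  have p: "r > 0" "d > 0" "e > 0" using pos by (auto simp: is_disc_def r_d_e_def)
  define x y where "x = fst D - fst C" "y = fst E - fst C"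
  have nx: "cmod x = r + d" and ny: "cmod y = r + e" and nxy: "cmod (y - x) = d + e"
    using tan by (auto simp: tangent_def x_y_def r_d_e_def dist_norm norm_minus_commute)
  define z where "z = y / x"
  have nz: "cmod z = (r + e) / (r + d)" by (simp add: z_def norm_divide nx ny)
  have x0: "x \<noteq> 0" using nx p by auto
  have "z - 1 = (y - x) / x" using x0 by (simp add: z_def field_simps)
  then have nz1: "cmod (z - 1) = (d + e) / (r + d)" by (simp add: norm_divide nx nxy)
  have "(cmod (z - 1))\<^sup>2 = (cmod z)\<^sup>2 - 2 * Re z + 1"
    unfolding cmod_power2 by (simp add: power2_eq_square algebra_simps)
  then have "2 * Re z = (cmod z)\<^sup>2 + 1 - (cmod (z - 1))\<^sup>2" by simp
  also have "\<dots> = ((r + e)\<^sup>2 + (r + d)\<^sup>2 - (d + e)\<^sup>2) / (r + d)\<^sup>2"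
    unfolding nz nz1 using p by (simp add: field_simps)
  finally have re: "Re z = ((r + e)\<^sup>2 + (r + d)\<^sup>2 - (d + e)\<^sup>2) / (r + d)\<^sup>2 / 2" by simp
  have z0: "z \<noteq> 0" using nz p by auto
  have "cos (Arg z) = Re z / cmod z"
    using z0 by (simp add: cos_Arg)
  also have "\<dots> = 1 - 2 * (d / (r + d)) * (e / (r + e))"
    unfolding re nz using p by (simp add: divide_simps) (simp add: algebra_simps power2_eq_square)
  finally have c: "cos (Arg z) = 1 - 2 * (d / (r + d)) * (e / (r + e))" .
  have "Arg z > 0" using ang by (simp add: petal_angle_def z_def x_y_def)
  then have "Arg z = arccos (cos (Arg z))" using Arg_bounded[of z] by (subst arccos_cos) auto
  then show ?thesis unfolding c
    by (simp add: petal_angle_def z_def x_y_def ang_def r_d_e_def)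
qed

section \<open>Disjoint discs and directions in a corona\<close>

text \<open>Otherwise the point dividing the segment of centers in the ratio of the radii is
  interior to both discs.\<close>

lemma int_disjoint_dist:
  assumes "is_disc C" "is_disc D" "int_disjoint C D"
  shows "snd C + snd D \<le> dist (fst C) (fst D)"
proof (rule ccontr)
  define r s where "r = snd C" and "s = snd D"
  define d where "d = dist (fst C) (fst D)"
  define x where "x = fst C + (r / (r + s)) *\<^sub>R (fst D - fst C)"
  assume "\<not> ?thesis"
  then have d: "d < r + s" by (simp add: d_def r_def s_def)
  have p: "r > 0" "s > 0" using assms by (auto simp: is_disc_def r_def s_def)
  have "dist (fst C) x = r / (r + s) * d"
    using p by (simp add: x_def d_def dist_norm norm_minus_commute)
  also have "\<dots> < r / (r + s) * (r + s)" using p d by (intro mult_strict_left_mono) auto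
  also have "\<dots> = r" using p by simp
  finally have 1: "x \<in> ball (fst C) r" by simp
  have "fst D - x = (1 - r / (r + s)) *\<^sub>R (fst D - fst C)"
    by (simp add: x_def algebra_simps)
  also have "1 - r / (r + s) = s / (r + s)" using p by (simp add: field_simps)
  finally have "dist (fst D) x = s / (r + s) * d"
    using p by (simp add: d_def dist_norm norm_minus_commute)
  also have "\<dots> < s / (r + s) * (r + s)" using p d by (intro mult_strict_left_mono) auto
  also have "\<dots> = s" using p by simp
  finally have "x \<in> ball (fst D) s" by simp
  with 1 show False
    using assms by (auto simp: int_disjoint_def disc_set_def interior_cball r_def s_def)
qed

lemma sgn_eq_imp_inner:
  fixes v w :: complex
  assumes "sgn v = sgn w * cis t" "w \<noteq> 0"
  shows "inner v w = cmod v * cmod w * cos t"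
proof -
  define a where "a = sgn w"
  have a: "(Re a)\<^sup>2 + (Im a)\<^sup>2 = 1"
    unfolding cmod_power2[symmetric] using assms(2) by (simp add: a_def norm_sgn)
  have polar: "u = cmod u *\<^sub>R sgn u" for u :: complex
    by (cases "u = 0") (simp_all add: sgn_div_norm)
  have "inner v w = inner (cmod v *\<^sub>R (a * cis t)) (cmod w *\<^sub>R a)"
    using polar[of v] polar[of w] assms(1) by (simp add: a_def)
  also have "\<dots> = cmod v * cmod w * inner (a * cis t) a" by simp
  also have "inner (a * cis t) a = ((Re a)\<^sup>2 + (Im a)\<^sup>2) * cos t"
    by (simp add: inner_complex_def algebra_simps power2_eq_square)
  finally show ?thesis using a by simp
qed

text \<open>The successive turns add up to a full turn, so the angle of \<open>v\<close> measured
  from \<open>z 0\<close> falls between two consecutive partial sums.\<close>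

lemma direction_in_sector:
  fixes z :: "nat \<Rightarrow> complex" and v :: complex
  assumes nz: "\<And>i. i < m \<Longrightarrow> z i \<noteq> 0" and v: "v \<noteq> 0"
    and sum: "(\<Sum>i<m. Arg (z (Suc i mod m) / z i)) = 2 * pi"
  obtains i t where "i < m" "0 \<le> t" "t \<le> Arg (z (Suc i mod m) / z i)"
    "sgn v = sgn (z i) * cis t"
    "sgn (z (Suc i mod m)) = sgn (z i) * cis (Arg (z (Suc i mod m) / z i))"
proof -
  define th where "th i = Arg (z (Suc i mod m) / z i)" for i
  define s where "s i = (\<Sum>j<i. th j)" for i
  have m: "m > 0" using sum by (cases m) auto
  have sm: "s m = 2 * pi" using sum by (simp add: s_def th_def)
  have step: "sgn (z (Suc i mod m)) = sgn (z i) * cis (th i)" if "i < m" for i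
  proof -
    have "z (Suc i mod m) / z i \<noteq> 0" using nz that m by auto
    then have "cis (th i) = sgn (z (Suc i mod m) / z i)" by (simp add: th_def cis_Arg)
    then have "sgn (z i) * cis (th i) = sgn (z i * (z (Suc i mod m) / z i))"
      by (simp only: sgn_mult)
    then show ?thesis using nz[OF that] by simp
  qed
  have pos: "sgn (z i) = sgn (z 0) * cis (s i)" if "i < m" for i
    using that
  proof (induction i)
    case (Suc i)
    then show ?case using step[of i] by (simp add: s_def mult.assoc cis_mult)
  qed (simp add: s_def)
  define al where "al = Arg2pi (v / z 0)"
  have al: "0 \<le> al" "al < 2 * pi" by (simp_all add: al_def Arg2pi_ge_0 Arg2pi_lt_2pi)
  have w: "v / z 0 \<noteq> 0" using v nz m by simp
  have "v / z 0 = of_real (cmod (v / z 0)) * cis al"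
    unfolding al_def cis_conv_exp by (rule Arg2pi_eq)
  then have "sgn (v / z 0) = sgn (of_real (cmod (v / z 0)) * cis al)" by simp
  also have "\<dots> = cis al"
    unfolding sgn_mult sgn_of_real using w by (simp add: sgn_div_norm[of "cis al"])
  finally have "sgn (v / z 0) = cis al" .
  then have "sgn (z 0) * cis al = sgn (z 0 * (v / z 0))" by (simp only: sgn_mult)
  then have sv: "sgn v = sgn (z 0) * cis al" using nz[OF m] by simp
  \<comment> \<open>Some partial sum exceeds \<open>al\<close> because \<open>s m = 2 * pi\<close>;
    the one before the first such is at most \<open>al\<close>.\<close>
  define i where "i = (LEAST i. al < s (Suc i))"
  have ex: "al < s (Suc (m - 1))" using al sm m by simp
  have i1: "al < s (Suc i)" unfolding i_def by (rule LeastI[of _ "m - 1"]) (rule ex)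
  have "i \<le> m - 1" unfolding i_def by (rule Least_le) (rule ex)
  then have im: "i < m" using m by simp
  have i2: "s i \<le> al"
  proof (cases i)
    case 0
    then show ?thesis using al by (simp add: s_def)
  next
    case (Suc j)
    then have "\<not> al < s (Suc j)" using not_less_Least[of j "\<lambda>i. al < s (Suc i)"] by (simp add: i_def)
    then show ?thesis using Suc by simp
  qed
  show thesis
  proof (rule that[OF im])
    show "0 \<le> al - s i" using i2 by simp
    show "al - s i \<le> Arg (z (Suc i mod m) / z i)"
      using i1 by (simp add: s_def th_def)
    show "sgn v = sgn (z i) * cis (al - s i)"
      using pos[OF im] sv by (simp add: mult.assoc cis_mult)
    show "sgn (z (Suc i mod m)) = sgn (z i) * cis (Arg (z (Suc i mod m) / z i))"
      using step[OF im] by (simp add: th_def)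
  qed
qed

text \<open>\<open>Q\<close> may be infinite, but discs for which the power of \<open>p\<close> is
  at most that for a fixed \<open>D0\<close> have centers in a bounded region, and distinct centers
  are at least the smallest radius apart. So only finitely many discs compete.\<close>

lemma minimal_power_exists:
  assumes disc: "\<And>D. D \<in> Q \<Longrightarrow> is_disc D"
    and disj: "\<And>D E. D \<in> Q \<Longrightarrow> E \<in> Q \<Longrightarrow> D \<noteq> E \<Longrightarrow> int_disjoint D E"
    and fin: "finite (radii Q)" and ne: "Q \<noteq> {}"
  obtains D where "D \<in> Q"
    "\<And>E. E \<in> Q \<Longrightarrow> (dist p (fst D))\<^sup>2 - (snd D)\<^sup>2 \<le> (dist p (fst E))\<^sup>2 - (snd E)\<^sup>2"
proof -
  define pw where "pw D = (dist p (fst D))\<^sup>2 - (snd D)\<^sup>2" for D :: disc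
  obtain D0 where D0: "D0 \<in> Q" using ne by blast
  define F where "F = {D \<in> Q. pw D \<le> pw D0}"
  have rne: "radii Q \<noteq> {}" using ne by (simp add: radii_def)
  define e R where "e = Min (radii Q)" and "R = Max (radii Q)"
  have eR: "e \<le> snd D" "snd D \<le> R" if "D \<in> Q" for D
    using that fin by (auto simp: e_def R_def radii_def)
  have "e \<in> radii Q" using fin rne by (simp add: e_def)
  then have e: "e > 0" using disc by (auto simp: radii_def is_disc_def)
  have far: "e \<le> dist (fst D) (fst E)" if "D \<in> Q" "E \<in> Q" "D \<noteq> E" for D E
    using int_disjoint_dist[OF disc disc disj] that eR(1)[of D] eR(1)[of E] e by fastforce
  have "uniform_discrete (fst ` F)"
    unfolding uniform_discrete_def using far e by (force simp: F_def)
  moreover have "bounded (fst ` F)"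
  proof (rule boundedI[of _ "norm p + sqrt (pw D0 + R\<^sup>2)"])
    fix x assume "x \<in> fst ` F"
    then obtain D where D: "D \<in> Q" "pw D \<le> pw D0" "x = fst D" by (auto simp: F_def)
    have "(snd D)\<^sup>2 \<le> R\<^sup>2" using eR[OF D(1)] e by (intro power_mono) auto
    then have "(dist p x)\<^sup>2 \<le> pw D0 + R\<^sup>2" using D by (simp add: pw_def)
    then have "dist p x \<le> sqrt (pw D0 + R\<^sup>2)" by (rule real_le_rsqrt)
    then show "norm x \<le> norm p + sqrt (pw D0 + R\<^sup>2)"
      using norm_triangle_ineq2[of x p] by (simp add: dist_norm norm_minus_commute)
  qed
  ultimately have "finite (fst ` F)" by (simp flip: uniform_discrete_finite_iff)
  moreover have "inj_on fst F"
  proof (rule inj_onI)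
    fix D E assume "D \<in> F" "E \<in> F" "fst D = fst E"
    then show "D = E" using far[of D E] e by (auto simp: F_def)
  qed
  ultimately have "finite F" by (simp add: finite_image_iff)
  moreover have "F \<noteq> {}" using D0 unfolding F_def by blast
  ultimately obtain D where D: "is_arg_min pw (\<lambda>x. x \<in> F) D"
    using ex_is_arg_min_if_finite by blast
  show thesis
  proof (rule that)
    show "D \<in> Q" using D by (auto simp: is_arg_min_def F_def)
    fix E assume E: "E \<in> Q"
    have "pw D \<le> pw D0" using D by (auto simp: is_arg_min_def F_def)
    moreover have "\<not> pw E < pw D" if "pw E \<le> pw D0"
      using D E that unfolding is_arg_min_def F_def by blast
    ultimately have "pw D \<le> pw E" by linarith
    then show "(dist p (fst D))\<^sup>2 - (snd D)\<^sup>2 \<le> (dist p (fst E))\<^sup>2 - (snd E)\<^sup>2"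
      by (simp add: pw_def)
  qed
qed

text \<open>\<open>v\<close> lies in the sector of two consecutive petals, at most half its angle
  away from one of them. That half angle is at most the one for two petals of radius
  \<open>R\<close>, whose squared cosine is \<open>(2 * R * r + r\<^sup>2) / (R + r)\<^sup>2\<close>
  with \<open>r = snd D\<close>. The conclusion is this cosine bound, cleared of
  denominators.\<close>

lemma corona_petal_close_to_direction:
  assumes cor: "corona D Ds m" and v: "v \<noteq> 0"
    and le: "\<And>i. i < m \<Longrightarrow> snd (Ds i) \<le> R"
  obtains i where "i < m" "0 \<le> inner v (fst (Ds i) - fst D)"
    "(cmod v)\<^sup>2 * (2 * R * snd D + (snd D)\<^sup>2) * (cmod (fst (Ds i) - fst D))\<^sup>2
      \<le> (R + snd D)\<^sup>2 * (inner v (fst (Ds i) - fst D))\<^sup>2"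
proof -
  define r where "r = snd D"
  define z where "z i = fst (Ds i) - fst D" for i
  have r: "r > 0" using cor by (simp add: corona_def is_disc_def r_def)
  have a: "snd (Ds i) > 0" if "i < m" for i using cor that by (simp add: corona_def is_disc_def)
  have nz: "cmod (z i) = r + snd (Ds i)" if "i < m" for i
    using cor that by (auto simp: corona_def tangent_def z_def r_def dist_norm)
  have z0: "z i \<noteq> 0" if "i < m" for i using nz[OF that] a[OF that] r by auto
  have sum: "(\<Sum>i<m. Arg (z (Suc i mod m) / z i)) = 2 * pi"
    using cor by (simp add: corona_def petal_angle_def z_def)
  obtain i t where i: "i < m" "0 \<le> t" "t \<le> Arg (z (Suc i mod m) / z i)"
    "sgn v = sgn (z i) * cis t"
    "sgn (z (Suc i mod m)) = sgn (z i) * cis (Arg (z (Suc i mod m) / z i))"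
    using direction_in_sector[OF z0 v sum] by blast
  define j where "j = Suc i mod m"
  have j: "j < m" using i(1) by (simp add: j_def)
  define th where "th = Arg (z j / z i)"
  define x y where "x = snd (Ds i) / (r + snd (Ds i))" and "y = snd (Ds j) / (r + snd (Ds j))"
  have tha: "th = ang r (snd (Ds i)) (snd (Ds j))"
    using petal_angle_eq_ang[of D "Ds i" "Ds j"] cor i(1) j
    by (simp add: corona_def petal_angle_def z_def th_def r_def j_def)
  have x: "0 < x" "x < 1" and y: "0 < y" "y < 1"
    using ratio_bounds r a[OF i(1)] a[OF j] by (auto simp: x_def y_def)
  have xy: "0 < x * y" "x * y < 1" using mult_unit_interval x y by auto
  have cth: "cos th = 1 - 2 * (x * y)"
    unfolding tha ang_def x_def[symmetric] y_def[symmetric] using xy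
    by (subst cos_arccos) (auto simp: mult.assoc)
  have Rp: "R > 0" using le[OF i(1)] a[OF i(1)] by simp
  have "x \<le> R / (r + R)" "y \<le> R / (r + R)"
    unfolding x_def y_def using r Rp a[OF i(1)] a[OF j] le[OF i(1)] le[OF j]
    by (auto intro!: ratio_mono)
  then have "x * y \<le> (R / (r + R))\<^sup>2" unfolding power2_eq_square
    using x y by (intro mult_mono) auto
  moreover have "1 - (R / (r + R))\<^sup>2 = (2 * R * r + r\<^sup>2) / (R + r)\<^sup>2"
  proof -
    have "2 * R * r + r\<^sup>2 = (R + r)\<^sup>2 - R\<^sup>2" by (simp add: power2_eq_square algebra_simps)
    then show ?thesis using r Rp by (simp add: power_divide diff_divide_distrib add.commute)
  qed
  ultimately have cc: "(2 * R * r + r\<^sup>2) / (R + r)\<^sup>2 \<le> (cos (th / 2))\<^sup>2"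
    using cth cos_double_cos[of "th / 2"] by simp
  have th: "0 \<le> th" "th \<le> pi" using i Arg_bounded[of "z j / z i"] by (auto simp: th_def j_def)
  note result = that
  \<comment> \<open>\<open>k\<close> will be the petal of the sector closer to the direction of
    \<open>v\<close>, and \<open>u\<close> the signed angle from it to \<open>v\<close>.\<close>
  have key: thesis if k: "k < m" and u: "\<bar>u\<bar> \<le> th / 2" "sgn v = sgn (z k) * cis u" for k u
  proof -
    have "cos (th / 2) \<le> cos \<bar>u\<bar>" using u th by (intro cos_monotone_0_pi_le) auto
    then have cu: "cos (th / 2) \<le> cos u" by simp
    have c0: "0 \<le> cos (th / 2)" using th by (intro cos_ge_zero) auto
    have inn: "inner v (z k) = cmod v * cmod (z k) * cos u"
      by (rule sgn_eq_imp_inner[OF u(2) z0[OF k]])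
    have "(cos (th / 2))\<^sup>2 \<le> (cos u)\<^sup>2" using cu c0 by (rule power_mono)
    then have "(2 * R * r + r\<^sup>2) / (R + r)\<^sup>2 \<le> (cos u)\<^sup>2" using cc by simp
    then have "2 * R * r + r\<^sup>2 \<le> (cos u)\<^sup>2 * (R + r)\<^sup>2"
      using r Rp by (subst (asm) pos_divide_le_eq) auto
    then have "(cmod v * cmod (z k))\<^sup>2 * (2 * R * r + r\<^sup>2)
        \<le> (cmod v * cmod (z k))\<^sup>2 * ((cos u)\<^sup>2 * (R + r)\<^sup>2)"
      by (rule mult_left_mono) simp
    then have "(cmod v)\<^sup>2 * (2 * R * r + r\<^sup>2) * (cmod (z k))\<^sup>2 \<le> (R + r)\<^sup>2 * (inner v (z k))\<^sup>2"
      by (simp add: inn power_mult_distrib mult_ac)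
    moreover have "0 \<le> inner v (z k)" unfolding inn using cu c0 by simp
    ultimately show thesis using result k by (simp add: z_def r_def)
  qed
  show thesis
  proof (cases "t \<le> th / 2")
    case True
    then show ?thesis using key[OF i(1), of t] i by simp
  next
    case False
    have "sgn v = sgn (z j) * cis (t - th)"
      using i(4,5) by (simp add: j_def[symmetric] th_def[symmetric] mult.assoc cis_mult)
    then show ?thesis
      using key[OF j, of "t - th"] False i(3) by (simp add: j_def[symmetric] th_def[symmetric])
  qed
qed

text \<open>
  Let \<open>D\<close> be a disc of the packing for which the power of the center of \<open>E\<close> is least. Then the center
  of \<open>E\<close> lies on the near side of the common tangent of \<open>D\<close> with each of its petals, hence in a polygon
  circumscribed about \<open>D\<close> whose vertices are too close to \<open>D\<close> for \<open>E\<close> to be disjoint from \<open>D\<close>.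
\<close>

lemma compact_packing_meets_larger_disc:
  assumes pack: "compact_packing Q" and fin: "finite (radii Q)" and ne: "Q \<noteq> {}"
    and E: "is_disc E" and le: "\<And>D. D \<in> Q \<Longrightarrow> snd D \<le> snd E"
  shows "\<exists>D\<in>Q. \<not> int_disjoint D E"
proof (rule ccontr)
  assume "\<not> ?thesis"
  then have dis: "int_disjoint D E" if "D \<in> Q" for D using that by blast
  have disc: "is_disc D" if "D \<in> Q" for D using pack that by (auto simp: compact_packing_def)
  obtain D where D: "D \<in> Q"
    and min: "\<And>F. F \<in> Q \<Longrightarrow>
      (dist (fst E) (fst D))\<^sup>2 - (snd D)\<^sup>2 \<le> (dist (fst E) (fst F))\<^sup>2 - (snd F)\<^sup>2"
  proof (rule minimal_power_exists[of Q "fst E"])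
    show "int_disjoint D F" if "D \<in> Q" "F \<in> Q" "D \<noteq> F" for D F
      using pack that unfolding compact_packing_def by blast
  qed (use disc fin ne in auto)
  obtain m Ds where cor: "corona D Ds m" and Ds: "\<And>i. i < m \<Longrightarrow> Ds i \<in> Q"
    using pack D unfolding compact_packing_def by blast
  define r R v where "r = snd D" and "R = snd E" and "v = fst E - fst D"
  have r: "r > 0" and R: "R > 0" using disc[OF D] E by (auto simp: is_disc_def r_def R_def)
  have nv: "R + r \<le> cmod v"
    using int_disjoint_dist[OF disc[OF D] E dis[OF D]]
    by (simp add: r_def R_def v_def dist_norm norm_minus_commute)
  then have "v \<noteq> 0" using r R by auto
  then obtain i where i: "i < m" and inn0: "0 \<le> inner v (fst (Ds i) - fst D)"
    and big: "(cmod v)\<^sup>2 * (2 * R * r + r\<^sup>2) * (cmod (fst (Ds i) - fst D))\<^sup>2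
      \<le> (R + r)\<^sup>2 * (inner v (fst (Ds i) - fst D))\<^sup>2"
    using corona_petal_close_to_direction[OF cor _ le[OF Ds]] unfolding r_def R_def by blast
  define z a where "z = fst (Ds i) - fst D" and "a = snd (Ds i)"
  have a: "a > 0" using disc[OF Ds[OF i]] by (simp add: a_def is_disc_def)
  have nz: "cmod z = r + a"
    using cor i by (auto simp: corona_def tangent_def z_def a_def r_def dist_norm)
  \<comment> \<open>Minimality of the power, compared with the petal, puts the center of
    \<open>E\<close> on the near side of the common tangent, which has distance \<open>r\<close>
    from the center of \<open>D\<close>.\<close>
  have "(cmod v)\<^sup>2 - r\<^sup>2 \<le> (cmod (v - z))\<^sup>2 - a\<^sup>2"
    using min[OF Ds[OF i]] by (simp add: dist_norm v_def z_def a_def r_def)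
  also have "(cmod (v - z))\<^sup>2 = (cmod v)\<^sup>2 - 2 * inner v z + (cmod z)\<^sup>2"
    by (simp add: power2_norm_eq_inner inner_diff_left inner_diff_right inner_commute)
  finally have "inner v z \<le> r * cmod z"
    unfolding nz by (simp add: power2_eq_square algebra_simps)
  then have "(inner v z)\<^sup>2 \<le> (r * cmod z)\<^sup>2" using inn0 by (intro power_mono) (simp_all add: z_def)
  \<comment> \<open>The cosine of the angle between \<open>v\<close> and \<open>z\<close> is now at
    most \<open>r / (R + r)\<close>, whereas \<open>big\<close> makes its square at least
    \<open>(2 * R * r + r\<^sup>2) / (R + r)\<^sup>2\<close>.\<close>
  then have "(R + r)\<^sup>2 * (inner v z)\<^sup>2 \<le> (cmod v)\<^sup>2 * (r * cmod z)\<^sup>2"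
    using power_mono[OF nv, of 2] r R by (intro mult_mono) auto
  then have "((cmod v)\<^sup>2 * (cmod z)\<^sup>2) * (2 * R * r + r\<^sup>2) \<le> ((cmod v)\<^sup>2 * (cmod z)\<^sup>2) * r\<^sup>2"
    using big by (simp add: z_def[symmetric] power_mult_distrib mult_ac)
  moreover have "0 < (cmod v)\<^sup>2 * (cmod z)\<^sup>2" using \<open>v \<noteq> 0\<close> nz r a by simp
  ultimately have "2 * R * r + r\<^sup>2 \<le> r\<^sup>2" by (simp only: mult_le_cancel_left_pos)
  then show False using r R by (simp add: mult_le_0_iff)
qed

section \<open>Petal data and the maximum principle\<close>

definition angle_sum :: "(nat \<Rightarrow> real) \<Rightarrow> nat \<Rightarrow> nat list \<Rightarrow> real" where
  "angle_sum \<rho> i cs =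
     (\<Sum>j<length cs. ang (\<rho> i) (\<rho> (cs ! j)) (\<rho> (cs ! (Suc j mod length cs))))"

text \<open>
  \<open>\<rho> i\<close> is the \<open>i\<close>-th smallest radius, and \<open>S i\<close> collects the sequences of petal classes around discs of
  radius \<open>\<rho> i\<close>. Recording all coronas instead of one per class makes the last condition available
  for every \<open>T\<close> at once.
\<close>

definition admissible :: "nat \<Rightarrow> (nat \<Rightarrow> real) \<Rightarrow> (nat \<Rightarrow> nat list set) \<Rightarrow> bool" where
  "admissible n \<rho> S \<longleftrightarrow>
     (\<forall>i<n. 0 < \<rho> i) \<and> (\<forall>i j. i \<le> j \<longrightarrow> j < n \<longrightarrow> \<rho> i \<le> \<rho> j) \<and>
     (\<forall>i<n. \<forall>cs\<in>S i. set cs \<subseteq> {..<n} \<and> angle_sum \<rho> i cs = 2 * pi) \<and>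
     (\<forall>T. T \<noteq> {} \<longrightarrow> T \<subseteq> {..<n - 1} \<longrightarrow> (\<exists>i\<in>T. \<exists>cs\<in>S i. \<not> set cs \<subseteq> T))"

lemma admissible_pos: "admissible n \<rho> S \<Longrightarrow> i < n \<Longrightarrow> 0 < \<rho> i"
  by (simp add: admissible_def)

lemma admissible_mono: "admissible n \<rho> S \<Longrightarrow> i \<le> j \<Longrightarrow> j < n \<Longrightarrow> \<rho> i \<le> \<rho> j"
  by (simp add: admissible_def)

lemma admissible_symbol:
  assumes "admissible n \<rho> S" "i < n" "cs \<in> S i"
  shows "set cs \<subseteq> {..<n}" "angle_sum \<rho> i cs = 2 * pi"
  using assms by (auto simp: admissible_def)

text \<open>The set \<open>T\<close> of classes with equality lies below the largest class, so some
  \<open>cs\<close> at a class \<open>i\<close> in \<open>T\<close> leaves \<open>T\<close>.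
  Relative to the center, no petal of \<open>cs\<close> is larger under \<open>\<rho>\<close> than
  under \<open>\<rho>'\<close>, and one is smaller. So the angle sums differ, although both are
  \<open>2 * pi\<close>.\<close>

lemma admissible_maximum_principle:
  assumes adm: "admissible n \<rho> S" and adm': "admissible n \<rho>' S'"
    and le: "\<And>j. j < n \<Longrightarrow> \<rho> j \<le> c * \<rho>' j"
    and touch: "i\<^sub>0 < n" "\<rho> i\<^sub>0 = c * \<rho>' i\<^sub>0"
    and same: "\<And>j. j < n \<Longrightarrow> \<rho> j = c * \<rho>' j \<Longrightarrow> j < n - 1 \<and> S j = S' j"
  shows False
proof -
  define T where "T = {j. j < n \<and> \<rho> j = c * \<rho>' j}"
  have "T \<noteq> {}" "T \<subseteq> {..<n - 1}" using touch same by (auto simp: T_def)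
  then obtain i cs where i: "i \<in> T" "cs \<in> S i" "\<not> set cs \<subseteq> T"
    using adm unfolding admissible_def by meson
  have inn: "i < n" and eq: "\<rho> i = c * \<rho>' i" and cs': "cs \<in> S' i"
    using i same by (auto simp: T_def)
  have cs: "cs ! j < n" if "j < length cs" for j
    using admissible_symbol(1)[OF adm inn i(2)] that nth_mem by blast
  obtain x where x: "x < length cs" "cs ! x \<notin> T" using i(3) by (metis in_set_conv_nth subsetI)
  have less: "\<rho> (cs ! x) < c * \<rho>' (cs ! x)"
    using le[OF cs[OF x(1)]] cs[OF x(1)] x(2) by (auto simp: T_def)
  note pos = admissible_pos[OF adm] admissible_pos[OF adm']
  \<comment> \<open>Equality at \<open>i\<close> turns domination by \<open>c * \<rho>'\<close> into
    a comparison of radii relative to the center.\<close>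
  have scale: "\<rho> j * \<rho>' i \<le> \<rho>' j * \<rho> i" if "j < n" for j
    using mult_right_mono[OF le[OF that], of "\<rho>' i"] pos(2)[OF inn] by (simp add: eq mult_ac)
  have "angle_sum \<rho> i cs < angle_sum \<rho>' i cs"
    unfolding angle_sum_def
  proof (rule sum_strict_mono_ex1)
    have c: "cs ! j < n" "cs ! (Suc j mod length cs) < n" if "j < length cs" for j
      using that by (auto intro!: cs mod_less_divisor)
    show "\<forall>j\<in>{..<length cs}. ang (\<rho> i) (\<rho> (cs ! j)) (\<rho> (cs ! (Suc j mod length cs)))
        \<le> ang (\<rho>' i) (\<rho>' (cs ! j)) (\<rho>' (cs ! (Suc j mod length cs)))"
      using c by (auto intro!: ang_mono pos inn scale)
    have "\<rho> (cs ! x) * \<rho>' i < \<rho>' (cs ! x) * \<rho> i"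
      using mult_strict_right_mono[OF less, of "\<rho>' i"] pos(2)[OF inn] by (simp add: eq mult_ac)
    then have "ang (\<rho> i) (\<rho> (cs ! x)) (\<rho> (cs ! (Suc x mod length cs)))
        < ang (\<rho>' i) (\<rho>' (cs ! x)) (\<rho>' (cs ! (Suc x mod length cs)))"
      using c[OF x(1)] by (intro ang_less pos inn scale)
    then show "\<exists>j\<in>{..<length cs}. ang (\<rho> i) (\<rho> (cs ! j)) (\<rho> (cs ! (Suc j mod length cs)))
        < ang (\<rho>' i) (\<rho>' (cs ! j)) (\<rho>' (cs ! (Suc j mod length cs)))"
      using x(1) by blast
  qed simp
  then show False
    using admissible_symbol(2)[OF adm inn i(2)] admissible_symbol(2)[OF adm' inn cs'] by simp
qed

text \<open>The largest quotient \<open>f i / g i\<close> is the least factor by which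
  \<open>g\<close> dominates \<open>f\<close>.\<close>

lemma touching_scale_exists:
  fixes f g :: "'a \<Rightarrow> real"
  assumes "finite I" "I \<noteq> {}" and g: "\<And>i. i \<in> I \<Longrightarrow> 0 < g i"
  obtains c i where "i \<in> I" "f i = c * g i" "\<And>j. j \<in> I \<Longrightarrow> f j \<le> c * g j"
proof -
  define c where "c = Max ((\<lambda>i. f i / g i) ` I)"
  have "c \<in> (\<lambda>i. f i / g i) ` I" unfolding c_def using assms by (intro Max_in) auto
  then obtain i where i: "i \<in> I" "c = f i / g i" by blast
  have "f j / g j \<le> c" if "j \<in> I" for j unfolding c_def using that assms by (intro Max_ge) auto
  then have "f j \<le> c * g j" if "j \<in> I" for j using that g by (simp add: pos_divide_le_eq)
  moreover have "f i = c * g i" using i g[OF i(1)] by simp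
  ultimately show thesis using that i(1) by blast
qed

text \<open>Take the least \<open>c\<close> for which \<open>c * \<rho>'\<close> dominates
  \<open>\<rho>\<close> on the first \<open>k\<close> classes; it is at least
  \<open>\<rho> 0 / \<rho>' 0\<close>. If the bound failed, domination would be strict from class
  \<open>k\<close> on, so equality would occur only at classes with equal data, against the maximum
  principle.\<close>

lemma admissible_ratio_le:
  assumes adm: "admissible n \<rho> S" and adm': "admissible n \<rho>' S'"
    and k: "0 < k" "k < n" and same: "\<And>i. i < k \<Longrightarrow> S i = S' i"
  shows "\<rho>' k \<le> \<rho> (n - 1) / \<rho> 0 * \<rho>' 0"
proof (rule ccontr)
  assume "\<not> ?thesis"
  moreover note pos = admissible_pos[OF adm] admissible_pos[OF adm']
  ultimately have gt: "\<rho> (n - 1) < \<rho> 0 / \<rho>' 0 * \<rho>' k"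
    using pos[of 0] k by (simp add: field_simps)
  obtain c i where i: "i < k" "\<rho> i = c * \<rho>' i" and c: "\<And>j. j < k \<Longrightarrow> \<rho> j \<le> c * \<rho>' j"
  proof (rule touching_scale_exists[of "{..<k}" \<rho>' \<rho>])
    show "0 < \<rho>' i" if "i \<in> {..<k}" for i using that k pos(2) by simp
  qed (use k in auto)
  have c0: "\<rho> 0 / \<rho>' 0 \<le> c" using c[of 0] pos(2)[of 0] k by (simp add: pos_divide_le_eq)
  moreover have "0 < \<rho> 0 / \<rho>' 0" using pos[of 0] k by simp
  ultimately have cp: "0 < c" by linarith
  have far: "\<rho> j < c * \<rho>' j" if "k \<le> j" "j < n" for j
  proof -
    have "\<rho> j \<le> \<rho> (n - 1)" using that by (intro admissible_mono[OF adm]) auto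
    also note gt
    also have "\<rho> 0 / \<rho>' 0 * \<rho>' k \<le> c * \<rho>' j"
      using c0 cp that pos(2)[of k] k admissible_mono[OF adm' that] by (intro mult_mono) auto
    finally show ?thesis .
  qed
  show False
  proof (rule admissible_maximum_principle[OF adm adm', of c i])
    show "\<rho> j \<le> c * \<rho>' j" if "j < n" for j using c[of j] far[of j] that by (cases "j < k") auto
    show "j < n - 1 \<and> S j = S' j" if "j < n" "\<rho> j = c * \<rho>' j" for j
      using far[of j] that same[of j] k by (cases "j < k") auto
  qed (use i k in auto)
qed

text \<open>Otherwise the least \<open>c\<close> with \<open>\<rho> \<le> c * \<rho>'\<close>
  exceeds 1. Equality then fails at the largest class, where both radii are 1, and the maximum
  principle applies.\<close>

lemma admissible_le:
  assumes adm: "admissible n \<rho> S" and adm': "admissible n \<rho>' S'"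
    and one: "\<rho> (n - 1) = 1" "\<rho>' (n - 1) = 1"
    and same: "\<And>i. i < n - 1 \<Longrightarrow> S i = S' i" and j: "j < n"
  shows "\<rho> j \<le> \<rho>' j"
proof (rule ccontr)
  assume gt: "\<not> ?thesis"
  note pos = admissible_pos[OF adm']
  obtain c i where i: "i < n" "\<rho> i = c * \<rho>' i" and c: "\<And>j. j < n \<Longrightarrow> \<rho> j \<le> c * \<rho>' j"
  proof (rule touching_scale_exists[of "{..<n}" \<rho>' \<rho>])
    show "0 < \<rho>' i" if "i \<in> {..<n}" for i using that pos by simp
  qed (use j in auto)
  have "1 * \<rho>' j < c * \<rho>' j" using gt c[OF j] by simp
  then have c1: "1 < c" using pos[OF j] by (simp only: mult_less_cancel_right_pos)
  show False
  proof (rule admissible_maximum_principle[OF adm adm' c i])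
    fix j assume j: "j < n" "\<rho> j = c * \<rho>' j"
    then have "j \<noteq> n - 1" using one c1 by auto
    then show "j < n - 1 \<and> S j = S' j" using same[of j] j by auto
  qed
qed

section \<open>Finiteness of the petal data and of the normalised radii\<close>

text \<open>Lists replace functions because \<open>admissible\<close> leaves \<open>S\<close>
  arbitrary outside the \<open>n\<close> classes; the prefix length \<open>k\<close> is the
  induction variable for finiteness.\<close>

definition symbol_tables :: "nat \<Rightarrow> nat \<Rightarrow> nat list set list set" where
  "symbol_tables n k = {map S [0..<k] | S. \<exists>\<rho>. admissible n \<rho> S}"

text \<open>One representative per table bounds, by \<open>admissible_ratio_le\<close>, all
  sequences with that table; the maximum over the finitely many tables is uniform.\<close>

lemma admissible_ratio_bounded:
  assumes "finite (symbol_tables n k)" "k < n"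
  shows "\<exists>M. \<forall>\<rho> S. admissible n \<rho> S \<longrightarrow> \<rho> k \<le> M * \<rho> 0"
proof (cases "k = 0")
  case True
  then show ?thesis by (intro exI[of _ 1]) simp
next
  case False
  have "\<exists>M. \<forall>\<rho> S. admissible n \<rho> S \<and> map S [0..<k] = xs \<longrightarrow> \<rho> k \<le> M * \<rho> 0"
    if xs: "xs \<in> symbol_tables n k" for xs
  proof -
    obtain \<rho> S where r: "admissible n \<rho> S" "map S [0..<k] = xs"
      using xs by (auto simp: symbol_tables_def)
    show ?thesis
    proof (intro exI allI impI, elim conjE)
      fix \<rho>' S' assume r': "admissible n \<rho>' S'" "map S' [0..<k] = xs"
      have "S i = S' i" if "i < k" for i
        using r(2) r'(2) that by (metis map_eq_conv atLeastLessThan_iff set_upt zero_le)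
      then show "\<rho>' k \<le> \<rho> (n - 1) / \<rho> 0 * \<rho>' 0"
        using r r' False assms(2) by (intro admissible_ratio_le[of n \<rho> S \<rho>' S']) auto
    qed
  qed
  then obtain M where M: "\<And>xs \<rho> S. xs \<in> symbol_tables n k \<Longrightarrow> admissible n \<rho> S \<Longrightarrow>
      map S [0..<k] = xs \<Longrightarrow> \<rho> k \<le> M xs * \<rho> 0"
    by metis
  define B where "B = Max (M ` symbol_tables n k)"
  show ?thesis
  proof (intro exI allI impI)
    fix \<rho> S assume a: "admissible n \<rho> S"
    let ?xs = "map S [0..<k]"
    have xs: "?xs \<in> symbol_tables n k" using a by (auto simp: symbol_tables_def)
    have "\<rho> k \<le> M ?xs * \<rho> 0" by (rule M[OF xs a refl])
    also have "\<dots> \<le> B * \<rho> 0"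
      using xs assms admissible_pos[OF a, of 0] by (intro mult_right_mono) (auto simp: B_def)
    finally show "\<rho> k \<le> B * \<rho> 0" .
  qed
qed

text \<open>All petals have radius at least \<open>\<rho> 0 \<ge> \<rho> k / M\<close>, so each
  angle is at least \<open>d\<close>, the angle at a disc of radius \<open>M\<close> between petals
  of radius 1. At most \<open>2 * pi / d\<close> of them fit.\<close>

lemma admissible_symbol_length_bounded:
  assumes "0 < M" and "k < n"
  shows "\<exists>N. \<forall>\<rho> S. admissible n \<rho> S \<and> \<rho> k \<le> M * \<rho> 0 \<longrightarrow> (\<forall>cs\<in>S k. length cs \<le> N)"
proof -
  define d where "d = ang M 1 1"
  have "1 / (M + 1) * (1 / (M + 1)) < (1::real)" "0 < 1 / (M + 1) * (1 / (M + 1))"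
    using assms mult_unit_interval[of "1 / (M + 1)" "1 / (M + 1)"] by auto
  then have d: "d > 0"
    unfolding d_def ang_def using arccos_less_arccos[of "1 - 2 * (1 / (M + 1)) * (1 / (M + 1))" 1]
    by (simp add: mult.assoc)
  show ?thesis
  proof (intro exI allI impI ballI, elim conjE)
    fix \<rho> S cs assume a: "admissible n \<rho> S" and M: "\<rho> k \<le> M * \<rho> 0" and cs: "cs \<in> S k"
    note pos = admissible_pos[OF a]
    have csn: "cs ! j < n" if "j < length cs" for j
      using admissible_symbol(1)[OF a assms(2) cs] that nth_mem by blast
    have le: "1 * \<rho> k \<le> \<rho> j * M" if "j < n" for j
    proof -
      have "M * \<rho> 0 \<le> M * \<rho> j" using admissible_mono[OF a, of 0 j] that assms by simp
      then show ?thesis using M by (simp add: mult.commute)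
    qed
    have "real (length cs) * d = (\<Sum>j<length cs. d)" by simp
    also have "\<dots> \<le> angle_sum \<rho> k cs"
      unfolding angle_sum_def
    proof (rule sum_mono)
      fix j assume "j \<in> {..<length cs}"
      then have "cs ! j < n" "cs ! (Suc j mod length cs) < n" by (auto intro!: csn mod_less_divisor)
      then show "d \<le> ang (\<rho> k) (\<rho> (cs ! j)) (\<rho> (cs ! (Suc j mod length cs)))"
        unfolding d_def using assms by (intro ang_mono pos le) auto
    qed
    also have "\<dots> = 2 * pi" by (rule admissible_symbol(2)[OF a assms(2) cs])
    finally have "real (length cs) \<le> 2 * pi / d" using d by (simp add: field_simps)
    then show "length cs \<le> nat \<lceil>2 * pi / d\<rceil>" by linarith
  qed
qed

lemma finite_symbol_tables: "k \<le> n \<Longrightarrow> finite (symbol_tables n k)"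
proof (induction k)
  case 0
  have "symbol_tables n 0 \<subseteq> {[]}" by (auto simp: symbol_tables_def)
  then show ?case by (rule finite_subset) simp
next
  case (Suc k)
  then have fin: "finite (symbol_tables n k)" and k: "k < n" by auto
  obtain M where M: "\<And>\<rho> S. admissible n \<rho> S \<Longrightarrow> \<rho> k \<le> M * \<rho> 0"
    using admissible_ratio_bounded[OF fin k] by blast
  \<comment> \<open>The bound on lengths requires a positive factor.\<close>
  have M': "\<rho> k \<le> max M 1 * \<rho> 0" if "admissible n \<rho> S" for \<rho> S
  proof -
    have "M * \<rho> 0 \<le> max M 1 * \<rho> 0"
      using admissible_pos[OF that, of 0] k by (intro mult_right_mono) auto
    then show ?thesis using M[OF that] by linarith
  qed
  obtain N where N: "\<And>\<rho> S cs. admissible n \<rho> S \<Longrightarrow> cs \<in> S k \<Longrightarrow> length cs \<le> N"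
    using admissible_symbol_length_bounded[OF _ k, of "max M 1"] M'
    by (metis less_max_iff_disj zero_less_one)
  define L where "L = {cs. set cs \<subseteq> {..<n} \<and> length cs \<le> N}"
  have "symbol_tables n (Suc k) \<subseteq> (\<lambda>(xs, s). xs @ [s]) ` (symbol_tables n k \<times> Pow L)"
  proof
    fix ys assume "ys \<in> symbol_tables n (Suc k)"
    then obtain S \<rho> where S: "ys = map S [0..<Suc k]" "admissible n \<rho> S"
      by (auto simp: symbol_tables_def)
    have "S k \<in> Pow L" using N[OF S(2)] admissible_symbol(1)[OF S(2) k] by (auto simp: L_def)
    moreover have "map S [0..<k] \<in> symbol_tables n k" using S by (auto simp: symbol_tables_def)
    ultimately show "ys \<in> (\<lambda>(xs, s). xs @ [s]) ` (symbol_tables n k \<times> Pow L)"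
      using S(1) by (intro image_eqI[of _ _ "(map S [0..<k], S k)"]) auto
  qed
  moreover have "finite L" unfolding L_def by (rule finite_lists_length_le) simp
  ultimately show ?case using fin by (meson finite_SigmaI finite_Pow_iff finite_imageI finite_subset)
qed

text \<open>By \<open>admissible_le\<close> in both directions, the data \<open>f\<close> below the
  largest class determine the radii \<open>g\<close>, so \<open>g\<close> factors through the finite
  range of \<open>f\<close>.\<close>

lemma finite_normalised_admissible:
  "finite {map \<rho> [0..<n] | \<rho>. \<rho> (n - 1) = 1 \<and> (\<exists>S. admissible n \<rho> S)}"
proof -
  define X where "X = {(\<rho>, S). \<rho> (n - 1) = 1 \<and> admissible n \<rho> S}"
  define f g where "f = (\<lambda>(\<rho> :: nat \<Rightarrow> real, S :: nat \<Rightarrow> nat list set). map S [0..<n - 1])"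
    and "g = (\<lambda>(\<rho> :: nat \<Rightarrow> real, S :: nat \<Rightarrow> nat list set). map \<rho> [0..<n])"
  have gf: "g x = g y" if "x \<in> X" "y \<in> X" "f x = f y" for x y
  proof -
    obtain \<rho> S \<rho>' S' where xy: "x = (\<rho>, S)" "y = (\<rho>', S')" by (metis surj_pair)
    have a: "admissible n \<rho> S" "admissible n \<rho>' S'" "\<rho> (n - 1) = 1" "\<rho>' (n - 1) = 1"
      "\<And>i. i < n - 1 \<Longrightarrow> S i = S' i"
      using that by (auto simp: xy X_def f_def)
    have "\<rho> j = \<rho>' j" if "j < n" for j
      using admissible_le[OF a(1,2,3,4) a(5) that] admissible_le[OF a(2,1,4,3) a(5)[symmetric] that]
      by linarith
    then show ?thesis by (simp add: xy g_def)
  qed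
  have "finite (f ` X)"
    by (rule finite_subset[OF _ finite_symbol_tables[of "n - 1" n]])
      (auto simp: f_def X_def symbol_tables_def)
  moreover have "g ` X \<subseteq> (\<lambda>u. g (inv_into X f u)) ` f ` X"
  proof
    fix u assume "u \<in> g ` X"
    then obtain x where x: "x \<in> X" "u = g x" by blast
    have "g x = g (inv_into X f (f x))"
      using x(1) by (intro gf) (auto intro: inv_into_into simp: f_inv_into_f)
    then show "u \<in> (\<lambda>u. g (inv_into X f u)) ` f ` X" using x by blast
  qed
  ultimately have "finite (g ` X)" by (meson finite_imageI finite_subset)
  then show ?thesis
    by (rule rev_finite_subset) (force simp: g_def X_def)
qed

section \<open>From packings to admissible radii\<close>

text \<open>The last condition of \<open>admissible\<close> is the geometric one. If a set
  \<open>T\<close> of classes below the largest were closed under taking petals, its discs would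
  form a compact packing \<open>Q\<close>, and a disc \<open>E\<close> of largest radius would
  overlap one of them.\<close>

lemma compact_n_packing_admissible:
  assumes pack: "compact_n_packing n P" and n: "n > 0"
  defines "\<rho> \<equiv> (!) (sorted_list_of_set (radii P))"
  shows "\<exists>S. admissible n \<rho> S"
proof -
  define L where "L = sorted_list_of_set (radii P)"
  have P: "compact_packing P" "finite (radii P)" "card (radii P) = n"
    using pack by (auto simp: compact_n_packing_def)
  have L: "set L = radii P" "length L = n" "sorted L" "distinct L" using P by (auto simp: L_def)
  have rho: "\<rho> i = L ! i" for i by (simp add: \<rho>_def L_def)
  have in_radii: "\<rho> i \<in> radii P" if "i < n" for i
    using L(1,2) that nth_mem by (fastforce simp: rho)
  have index: "\<exists>i<n. snd D = \<rho> i" if "D \<in> P" for D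
    using that L(1,2) by (metis image_eqI in_set_conv_nth radii_def rho)
  have pos: "0 < \<rho> i" if "i < n" for i
    using in_radii[OF that] P(1) by (auto simp: radii_def compact_packing_def is_disc_def)
  have mono: "\<rho> i \<le> \<rho> j" if "i \<le> j" "j < n" for i j
    using L(2,3) that by (auto simp: rho intro: sorted_nth_mono)
  define S where "S i = {cs. \<exists>C Ds. C \<in> P \<and> snd C = \<rho> i \<and> corona C Ds (length cs) \<and>
      (\<forall>j<length cs. Ds j \<in> P \<and> cs ! j < n \<and> snd (Ds j) = \<rho> (cs ! j))}" for i
  have sym: "set cs \<subseteq> {..<n} \<and> angle_sum \<rho> i cs = 2 * pi" if cs: "cs \<in> S i" for i cs
  proof -
    obtain C Ds where C: "C \<in> P" "snd C = \<rho> i" and cor: "corona C Ds (length cs)"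
      and Ds: "\<And>j. j < length cs \<Longrightarrow> Ds j \<in> P \<and> cs ! j < n \<and> snd (Ds j) = \<rho> (cs ! j)"
      using cs unfolding S_def by blast
    have "angle_sum \<rho> i cs = (\<Sum>j<length cs. petal_angle C (Ds j) (Ds (Suc j mod length cs)))"
      unfolding angle_sum_def
    proof (rule sum.cong[OF refl])
      fix j assume "j \<in> {..<length cs}"
      then have j: "j < length cs" "Suc j mod length cs < length cs" by (auto intro!: mod_less_divisor)
      show "ang (\<rho> i) (\<rho> (cs ! j)) (\<rho> (cs ! (Suc j mod length cs)))
          = petal_angle C (Ds j) (Ds (Suc j mod length cs))"
        using petal_angle_eq_ang[of C "Ds j" "Ds (Suc j mod length cs)"] cor j Ds[OF j(1)] Ds[OF j(2)] C
        by (simp add: corona_def)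
    qed
    then show ?thesis using cor Ds by (auto simp: corona_def in_set_conv_nth)
  qed
  have esc: "\<exists>i\<in>T. \<exists>cs\<in>S i. \<not> set cs \<subseteq> T" if T: "T \<noteq> {}" "T \<subseteq> {..<n - 1}" for T
  proof (rule ccontr)
    assume "\<not> ?thesis"
    then have closed: "set cs \<subseteq> T" if "i \<in> T" "cs \<in> S i" for i cs using that by blast
    define Q where "Q = {D \<in> P. snd D \<in> \<rho> ` T}"
    have "\<exists>m Ds. corona C Ds m \<and> (\<forall>i<m. Ds i \<in> Q)" if C: "C \<in> Q" for C
    proof -
      obtain i where i: "i \<in> T" "snd C = \<rho> i" using C by (auto simp: Q_def)
      have CP: "C \<in> P" using C by (simp add: Q_def)
      then obtain m Ds where cor: "corona C Ds m" and Ds: "\<And>j. j < m \<Longrightarrow> Ds j \<in> P"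
        using P(1) unfolding compact_packing_def by blast
      have "\<forall>j. \<exists>i. j < m \<longrightarrow> i < n \<and> snd (Ds j) = \<rho> i" using index Ds by blast
      then obtain ix where ix: "\<And>j. j < m \<Longrightarrow> ix j < n \<and> snd (Ds j) = \<rho> (ix j)"
        using choice[of "\<lambda>j i. j < m \<longrightarrow> i < n \<and> snd (Ds j) = \<rho> i"] by blast
      have "map ix [0..<m] \<in> S i"
        unfolding S_def mem_Collect_eq
        by (intro exI[of _ C] exI[of _ Ds]) (use CP i cor Ds ix in auto)
      from closed[OF i(1) this] have "ix j \<in> T" if "j < m" for j using that by auto
      then have "Ds j \<in> Q" if "j < m" for j using that ix Ds by (auto simp: Q_def)
      then show ?thesis using cor by blast
    qed
    moreover have QP: "Q \<subseteq> P" by (auto simp: Q_def)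
    ultimately have "compact_packing Q" using P(1) unfolding compact_packing_def by blast
    moreover have "finite (radii Q)"
      using P(2) QP unfolding radii_def by (meson finite_subset image_mono)
    moreover have "Q \<noteq> {}"
    proof -
      obtain i where i: "i \<in> T" using T by blast
      then have "\<rho> i \<in> radii P" using T by (intro in_radii) auto
      then obtain D where "D \<in> P" "snd D = \<rho> i" by (auto simp: radii_def)
      then show ?thesis using i unfolding Q_def by blast
    qed
    moreover obtain E where E: "E \<in> P" "snd E = \<rho> (n - 1)"
      using in_radii[of "n - 1"] n by (auto simp: radii_def)
    moreover have "is_disc E" using P(1) E by (auto simp: compact_packing_def)
    moreover have "snd D \<le> snd E" if "D \<in> Q" for D
      using that T E n mono by (force simp: Q_def)
    ultimately obtain D where D: "D \<in> Q" "\<not> int_disjoint D E"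
      using compact_packing_meets_larger_disc[of Q E] by blast
    \<comment> \<open>Distinct discs of \<open>P\<close> do not overlap, so \<open>E\<close> itself
      is in \<open>Q\<close>. But its class \<open>n - 1\<close> is not in \<open>T\<close>, and
      different classes have different radii.\<close>
    then have "D = E" using P(1) QP E unfolding compact_packing_def by blast
    then obtain i where i: "i \<in> T" "\<rho> (n - 1) = \<rho> i" using D E by (auto simp: Q_def)
    then have "i < n - 1" using T by auto
    then show False using i(2) L by (simp add: rho nth_eq_iff_index_eq)
  qed
  have "admissible n \<rho> S"
    unfolding admissible_def
    by (intro conjI allI impI ballI pos mono sym[THEN conjunct1] sym[THEN conjunct2] esc)
  then show ?thesis by blast
qed

theorem theorem1p1:
  fixes n :: nat
  shows "finite {radii P | P. compact_n_packing n P \<and> Max (radii P) = 1}"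
proof (cases "n = 0")
  case True
  \<comment> \<open>The only possible set of radii is empty, whatever value \<open>Max {}\<close>
    has.\<close>
  then have "{radii P | P. compact_n_packing n P \<and> Max (radii P) = 1} \<subseteq> {{}}"
    by (auto simp: compact_n_packing_def)
  then show ?thesis by (rule finite_subset) simp
next
  case False
  have "{radii P | P. compact_n_packing n P \<and> Max (radii P) = 1}
      \<subseteq> set ` {map \<rho> [0..<n] | \<rho>. \<rho> (n - 1) = 1 \<and> (\<exists>S. admissible n \<rho> S)}"
  proof (rule subsetI, elim CollectE exE conjE)
    fix R P assume R: "R = radii P" and P: "compact_n_packing n P" "Max (radii P) = 1"
    define L where "L = sorted_list_of_set (radii P)"
    have fin: "finite (radii P)" "card (radii P) = n" using P by (auto simp: compact_n_packing_def)
    then have L: "set L = radii P" "length L = n" by (auto simp: L_def)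
    obtain S where S: "admissible n ((!) L) S"
      using compact_n_packing_admissible[OF P(1)] False by (auto simp: L_def)
    have "Max (radii P) = L ! (n - 1)"
    proof (rule Max_eqI[OF fin(1)])
      show "L ! (n - 1) \<in> radii P" using L False by (metis diff_less neq0_conv nth_mem zero_less_one)
      fix y assume "y \<in> radii P"
      then obtain i where "i < n" "y = L ! i" using L by (metis in_set_conv_nth)
      then show "y \<le> L ! (n - 1)" using admissible_mono[OF S, of i "n - 1"] by simp
    qed
    moreover have "radii P = set (map ((!) L) [0..<n])" using L map_nth[of L] by simp
    ultimately show "R \<in> set ` {map \<rho> [0..<n] | \<rho>. \<rho> (n - 1) = 1 \<and> (\<exists>S. admissible n \<rho> S)}"
      unfolding R using P(2) S
      by (intro image_eqI[of _ _ "map ((!) L) [0..<n]"]) auto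
  qed
  then show ?thesis by (rule finite_subset) (intro finite_imageI finite_normalised_admissible)
qed

end
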